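(* Let $D$ be a skew field, let $V$ be a two-dimensional right vector space over $D$, and let $H$ be a group with $\mathrm{PEL}(V)\subseteq H\subseteq\mathrm{PGL}(V)$, acting on the set $\mathrm{Gr}_1(V)$ of one-dimensional subspaces of $V$. Then for every $x\in\mathrm{Gr}_1(V)$ the stabilizer $H_x$ contains a unique normal subgroup which acts regularly on $\mathrm{Gr}_1(V)\setminus\{x\}$. In other words, there is a unique way of making $(H,\mathrm{Gr}_1(V))$ into a Moufang set.
   Context: A skew field is a (not necessarily commutative) division ring. $\mathrm{GL}(V)$ is the group of $D$-linear bijections of $V$. A transvection of $V$ is a map $v\mapsto v+u\rho(v)$ with $u\in V$, $\rho\in\mathrm{Hom}_D(V,D)$ and $\rho(u)=0$; $\mathrm{EL}(V)\le\mathrm{GL}(V)$ is the subgroup generated by all transvections. $\mathrm{PGL}(V)$ and $\mathrm{PEL}(V)$ are the permutation groups induced by $\mathrm{GL}(V)$ and $\mathrm{EL}(V)$ on $\mathrm{Gr}_1(V)$. A Moufang set is a triple $(G,U,X)$, where $G$ is a group acting on a set $X$ with at least 3 elements and $U\le G$ is a subgroup, such that: the action of $G$ on $X$ is 2-transitive; $U$ fixes a point $x\in X$ and acts regularly (sharply transitively) on $X\setminus\{x\}$; and $U$ is normal in the stabilizer $G_x$. One says that $U$ makes $(G,X)$ into a Moufang set. *)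

theory Defs
  imports "HOL-Algebra.Group_Action" "HOL-Algebra.Generated_Groups"
begin

section \<open>Right vector spaces over skew fields\<close>

text \<open>
  The library's modules and vector spaces have commutative scalars. A skew field is a type of
  class \<^class>\<open>division_ring\<close>, and the vector space is a whole type.
\<close>

locale right_vector_space =
  fixes scale :: "'v::ab_group_add \<Rightarrow> 'd::division_ring \<Rightarrow> 'v"
  assumes scale_add_left: "scale (v + w) a = scale v a + scale w a"
    and scale_add_right: "scale v (a + b) = scale v a + scale v b"
    and scale_scale: "scale (scale v a) b = scale v (a * b)"
    and scale_one: "scale v 1 = v"

definition right_subspace ::
    "('v::ab_group_add \<Rightarrow> 'd::division_ring \<Rightarrow> 'v) \<Rightarrow> 'v set \<Rightarrow> bool" where
  "right_subspace scale W \<longleftrightarrow>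
     0 \<in> W \<and> (\<forall>v\<in>W. \<forall>w\<in>W. v + w \<in> W) \<and> (\<forall>v\<in>W. \<forall>a. scale v a \<in> W)"

definition is_basis_of ::
    "('v::ab_group_add \<Rightarrow> 'd::division_ring \<Rightarrow> 'v) \<Rightarrow> 'v set \<Rightarrow> 'v set \<Rightarrow> bool" where
  "is_basis_of scale W B \<longleftrightarrow>
     (\<forall>c. \<forall>F\<subseteq>B. finite F \<longrightarrow> (\<Sum>v\<in>F. scale v (c v)) = 0 \<longrightarrow> (\<forall>v\<in>F. c v = 0)) \<and>
     W = {\<Sum>v\<in>F. scale v (c v) | F c. finite F \<and> F \<subseteq> B}"

definition has_dimension ::
    "('v::ab_group_add \<Rightarrow> 'd::division_ring \<Rightarrow> 'v) \<Rightarrow> 'v set \<Rightarrow> nat \<Rightarrow> bool" where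
  "has_dimension scale W n \<longleftrightarrow> (\<exists>B. finite B \<and> card B = n \<and> is_basis_of scale W B)"

definition Gr ::
    "('v::ab_group_add \<Rightarrow> 'd::division_ring \<Rightarrow> 'v) \<Rightarrow> nat \<Rightarrow> 'v set set" where
  "Gr scale k = {W. right_subspace scale W \<and> has_dimension scale W k}"

text \<open>Taking \<^term>\<open>scale2 = (*)\<close> gives the linear forms.\<close>

definition right_linear ::
    "('v::ab_group_add \<Rightarrow> 'd::division_ring \<Rightarrow> 'v) \<Rightarrow> ('w::ab_group_add \<Rightarrow> 'd \<Rightarrow> 'w) \<Rightarrow>
     ('v \<Rightarrow> 'w) \<Rightarrow> bool" where
  "right_linear scale1 scale2 f \<longleftrightarrow>
     (\<forall>v w. f (v + w) = f v + f w) \<and> (\<forall>v a. f (scale1 v a) = scale2 (f v) a)"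


section \<open>Linear groups and the permutation groups they induce on lines\<close>

definition GL ::
    "('v::ab_group_add \<Rightarrow> 'd::division_ring \<Rightarrow> 'v) \<Rightarrow> ('v \<Rightarrow> 'v) monoid" where
  "GL scale = (BijGroup UNIV)\<lparr>carrier := {g. bij g \<and> right_linear scale scale g}\<rparr>"

definition transvections ::
    "('v::ab_group_add \<Rightarrow> 'd::division_ring \<Rightarrow> 'v) \<Rightarrow> ('v \<Rightarrow> 'v) set" where
  "transvections scale =
     {(\<lambda>v. v + scale u (\<rho> v)) | u \<rho>. right_linear scale (*) \<rho> \<and> \<rho> u = 0}"

definition EL ::
    "('v::ab_group_add \<Rightarrow> 'd::division_ring \<Rightarrow> 'v) \<Rightarrow> ('v \<Rightarrow> 'v) set" where
  "EL scale = generate (GL scale) (transvections scale)"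

text \<open>Restriction to the set of lines because \<^const>\<open>BijGroup\<close> has extensional functions.\<close>

definition induced_on_lines ::
    "('v::ab_group_add \<Rightarrow> 'd::division_ring \<Rightarrow> 'v) \<Rightarrow> ('v \<Rightarrow> 'v) \<Rightarrow> 'v set \<Rightarrow> 'v set" where
  "induced_on_lines scale g = (\<lambda>L\<in>Gr scale 1. g ` L)"

definition PGL ::
    "('v::ab_group_add \<Rightarrow> 'd::division_ring \<Rightarrow> 'v) \<Rightarrow> ('v set \<Rightarrow> 'v set) set" where
  "PGL scale = induced_on_lines scale ` carrier (GL scale)"

definition PEL ::
    "('v::ab_group_add \<Rightarrow> 'd::division_ring \<Rightarrow> 'v) \<Rightarrow> ('v set \<Rightarrow> 'v set) set" where
  "PEL scale = induced_on_lines scale ` EL scale"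


section \<open>Moufang sets\<close>

definition acts_regularly :: "('g \<Rightarrow> 'x \<Rightarrow> 'x) \<Rightarrow> 'g set \<Rightarrow> 'x set \<Rightarrow> bool" where
  "acts_regularly \<alpha> U Y \<longleftrightarrow>
     (\<forall>u\<in>U. \<forall>y\<in>Y. \<alpha> u y \<in> Y) \<and> (\<forall>y\<in>Y. \<forall>z\<in>Y. \<exists>!u. u \<in> U \<and> \<alpha> u y = z)"

definition two_transitive ::
    "('g, 'm) monoid_scheme \<Rightarrow> ('g \<Rightarrow> 'x \<Rightarrow> 'x) \<Rightarrow> 'x set \<Rightarrow> bool" where
  "two_transitive G \<alpha> X \<longleftrightarrow>
     (\<forall>x\<in>X. \<forall>y\<in>X. \<forall>x'\<in>X. \<forall>y'\<in>X. x \<noteq> y \<longrightarrow> x' \<noteq> y' \<longrightarrow>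
        (\<exists>g\<in>carrier G. \<alpha> g x = x' \<and> \<alpha> g y = y'))"

abbreviation stabilizer_group ::
    "('g, 'm) monoid_scheme \<Rightarrow> ('g \<Rightarrow> 'x \<Rightarrow> 'x) \<Rightarrow> 'x \<Rightarrow> ('g, 'm) monoid_scheme" where
  "stabilizer_group G \<alpha> x \<equiv> G\<lparr>carrier := stabilizer G \<alpha> x\<rparr>"

definition moufang_set ::
    "('g, 'm) monoid_scheme \<Rightarrow> ('g \<Rightarrow> 'x \<Rightarrow> 'x) \<Rightarrow> 'g set \<Rightarrow> 'x set \<Rightarrow> bool" where
  "moufang_set G \<alpha> U X \<longleftrightarrow>
     group_action G X \<alpha> \<and> (infinite X \<or> card X \<ge> 3) \<and> two_transitive G \<alpha> X \<and> subgroup U G \<and>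
     (\<exists>x\<in>X. (\<forall>u\<in>U. \<alpha> u x = x) \<and> acts_regularly \<alpha> U (X - {x}) \<and>
            U \<lhd> stabilizer_group G \<alpha> x)"

text \<open>
  In a Moufang set the point fixed by \<open>U\<close> is determined by \<open>U\<close>, and conjugating \<open>U\<close> moves it.
  So \<open>U\<close> can only be unique once its fixed point is prescribed.
\<close>

definition unique_moufang_set ::
    "('g, 'm) monoid_scheme \<Rightarrow> ('g \<Rightarrow> 'x \<Rightarrow> 'x) \<Rightarrow> 'x set \<Rightarrow> bool" where
  "unique_moufang_set G \<alpha> X \<longleftrightarrow>
     (\<forall>x\<in>X. \<exists>!U. moufang_set G \<alpha> U X \<and> (\<forall>u\<in>U. \<alpha> u x = x))"

abbreviation permutation_group :: "'x set \<Rightarrow> ('x \<Rightarrow> 'x) set \<Rightarrow> ('x \<Rightarrow> 'x) monoid" where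
  "permutation_group X H \<equiv> (BijGroup X)\<lparr>carrier := H\<rparr>"

end

theory Submission
  imports Defs
begin

text \<open>
  Let \<open>H\<^sub>x\<close> be the stabilizer of a line \<open>x\<close>. It acts on the other lines, parametrized by \<open>D\<close>, by affine
  maps \<open>t \<mapsto> \<alpha> t \<beta> + c\<close>. It contains all translations, which form a normal regular subgroup \<open>U\<close>, and
  all maps \<open>t \<mapsto> \<alpha> t \<alpha>\<close>. Let \<open>N\<close> be another normal regular subgroup. If \<open>N \<subseteq> U\<close>, then \<open>N = U\<close>
  by regularity. Otherwise \<open>N\<close> has an element whose linear part \<open>t \<mapsto> \<alpha> t \<beta>\<close> is not the identity, and
  its commutators with translations show that the set \<open>A\<close> of all \<open>a\<close> whose translation lies in \<open>N\<close>
  contains \<open>\<alpha> t \<beta> - t\<close> for all \<open>t\<close>. If \<open>D\<close> is commutative, then \<open>A \<supseteq> (\<alpha> \<beta> - 1) D = D\<close>. If not, \<open>A\<close> is a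
  nonzero additive subgroup closed under \<open>a \<mapsto> s a s\<close>, and so it is a right module over a division
  subring of \<open>D\<close> that contains all squares. That subring contains all multiplicative commutators,
  hence is \<open>D\<close>, and again \<open>A = D\<close>. So \<open>U \<subseteq> N\<close>, and regularity gives \<open>N = U\<close>.
\<close>

section \<open>Additive subgroups of skew fields\<close>

text \<open>The right multipliers \<open>S\<close> of \<open>A\<close> form a ring closed under
  inverses and containing every square, hence every multiplicative commutator and then every
  noncentral element. Differences of these give the whole skew field, so \<open>A\<close> is a
  nonzero right ideal.\<close>

lemma additive_subgroup_eq_UNIV_if_sandwich_closed:
  fixes A :: "'d::division_ring set"
  assumes diff: "\<And>a b. a \<in> A \<Longrightarrow> b \<in> A \<Longrightarrow> a - b \<in> A"
    and sandwich: "\<And>a x. a \<in> A \<Longrightarrow> x * a * x \<in> A"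
    and nonzero: "t \<in> A" "t \<noteq> 0"
    and noncomm: "p * q \<noteq> q * (p :: 'd)"
  shows "A = UNIV"
proof -
  have zero: "0 \<in> A" using diff[OF nonzero(1) nonzero(1)] by simp
  define S where "S = {s. \<forall>a\<in>A. a * s \<in> A}"
  have S_diff: "r - s \<in> S" if "r \<in> S" "s \<in> S" for r s
    using that diff by (simp add: S_def right_diff_distrib)
  have S_mult: "r * s \<in> S" if "r \<in> S" "s \<in> S" for r s
    using that by (simp add: S_def mult.assoc[symmetric])
  have S_one: "1 \<in> S" by (simp add: S_def)
  have S_square: "x * x \<in> S" for x
    unfolding S_def
  proof (intro CollectI ballI)
    txt \<open>With \<open>a w = x\<^sup>-\<^sup>1\<close>, the nested sandwich \<open>x x (a (w a w) a) x x\<close> collapses to \<open>a x x\<close>.\<close>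
    fix a assume a: "a \<in> A"
    show "a * (x * x) \<in> A"
    proof (cases "x = 0 \<or> a = 0")
      case True
      then show ?thesis using zero by auto
    next
      case False
      define w where "w = inverse (x * a)"
      have "a * w = inverse x"
        using False by (simp add: w_def nonzero_inverse_mult_distrib mult.assoc[symmetric])
      then have aw: "a * (w * z) = inverse x * z" for z
        by (simp add: mult.assoc[symmetric])
      have cancel: "x * (inverse x * z) = z" for z
        using False by (simp add: mult.assoc[symmetric])
      have "(x * x) * (a * (w * a * w) * a) * (x * x) = a * (x * x)"
        by (simp only: mult.assoc aw cancel)
      then show ?thesis
        using sandwich[OF sandwich[OF sandwich[OF a, of w], of a], of "x * x"] by (simp only:)
    qed
  qed
  have S_inverse: "inverse s \<in> S" if "s \<in> S" for s
  proof (cases "s = 0")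
    case False
    \<comment> \<open>Inverses come from squares: \<open>inverse s\<close> is \<open>s\<close> times
      the square of \<open>inverse s\<close>.\<close>
    have "s * (inverse s * inverse s) = inverse s"
      using False by (simp add: mult.assoc[symmetric])
    then show ?thesis using S_mult[OF that S_square[of "inverse s"]] by simp
  qed (use that in simp)
  have S_commutator: "a * b * inverse a * inverse b \<in> S" if "a \<noteq> 0" "b \<noteq> 0" for a b
  proof -
    \<comment> \<open>A commutator is a product of three squares, those of \<open>a\<close>,
      \<open>inverse a * b\<close> and \<open>inverse b\<close>.\<close>
    have "(a * a) * ((inverse a * b) * (inverse a * b)) * (inverse b * inverse b)
        = a * (a * inverse a) * b * inverse a * (b * inverse b) * inverse b"
      by (simp only: mult.assoc)
    also have "\<dots> = a * b * inverse a * inverse b"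
      using that by simp
    finally show ?thesis
      using S_mult[OF S_mult[OF S_square[of a] S_square[of "inverse a * b"]] S_square[of "inverse b"]]
      by (simp only:)
  qed
  txt \<open>Subtracting the commutators of \<open>y\<close> with \<open>x\<close> and with \<open>x + 1\<close> and solving for \<open>x\<close>.\<close>
  have S_noncentral: "x \<in> S" if xy: "x * y \<noteq> y * x" for x y
  proof -
    have nz: "x \<noteq> 0" "y \<noteq> 0" "x + 1 \<noteq> 0"
      using xy by (auto simp: add_eq_0_iff2)
    define c where "c = y * x * inverse y * inverse x"
    define d where "d = y * (x + 1) * inverse y * inverse (x + 1)"
    have c: "c * x = y * x * inverse y"
      using nz by (simp add: c_def mult.assoc)
    have d: "d * (x + 1) = y * x * inverse y + 1"
    proof -
      have "d * (x + 1) = y * (x + 1) * inverse y"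
        using nz by (simp add: d_def mult.assoc)
      then show ?thesis
        using nz by (simp add: distrib_left distrib_right)
    qed
    have eq: "(c - d) * x = d - 1"
    proof -
      have "d * x + d = c * x + 1" using c d by (simp add: distrib_left)
      then have "d * x = c * x + 1 - d" by (metis add_diff_cancel_right')
      then show ?thesis by (simp add: left_diff_distrib)
    qed
    \<comment> \<open>Equality would force \<open>d = 1\<close>, and then \<open>x\<close> would
      commute with \<open>y\<close>.\<close>
    have "c \<noteq> d"
    proof
      assume "c = d"
      then have "d = 1" using eq by simp
      then have "x = y * x * inverse y" using d by simp
      then have "x * y = y * x * (inverse y * y)" by (metis mult.assoc)
      then show False using nz xy by simp
    qed
    then have "x = inverse (c - d) * (d - 1)"
      using eq[symmetric] by (simp add: mult.assoc[symmetric])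
    moreover have "c \<in> S" "d \<in> S"
      using S_commutator nz by (auto simp: c_def d_def)
    ultimately show ?thesis
      using S_mult[OF S_inverse[OF S_diff] S_diff[OF _ S_one]] by simp
  qed
  have "x \<in> S" for x
  proof (cases "x * q = q * x")
    case True
    \<comment> \<open>Here \<open>x\<close> commutes with \<open>q\<close> and \<open>p\<close> does
      not, so \<open>x\<close> is the difference of the noncentral elements \<open>x + p\<close> and
      \<open>p\<close>.\<close>
    then have "(x + p) * q \<noteq> q * (x + p)"
      using noncomm by (simp add: distrib_left distrib_right)
    then show ?thesis using S_diff[OF S_noncentral S_noncentral[OF noncomm]] by fastforce
  qed (rule S_noncentral)
  then have "t * (inverse t * a) \<in> A" for a
    using nonzero(1) by (auto simp: S_def)
  then have "a \<in> A" for a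
    using nonzero(2) by (simp add: mult.assoc[symmetric])
  then show ?thesis by auto
qed

section \<open>Permutation groups\<close>

text \<open>Lets later arguments take products and inverses in the full permutation group although
  normality refers to a point stabilizer.\<close>

lemma (in group) normal_in_subgroup_iff:
  assumes K: "subgroup K G"
  shows "N \<lhd> G\<lparr>carrier := K\<rparr> \<longleftrightarrow>
    subgroup N G \<and> N \<subseteq> K \<and> (\<forall>g\<in>K. \<forall>h\<in>N. g \<otimes> h \<otimes> inv g \<in> N)"
proof -
  interpret K: group "G\<lparr>carrier := K\<rparr>" by (rule subgroup_imp_group[OF K])
  have "subgroup N (G\<lparr>carrier := K\<rparr>) \<longleftrightarrow> subgroup N G \<and> N \<subseteq> K"
    using incl_subgroup[OF K] subgroup_incl[OF _ K] subgroup.subset[of N "G\<lparr>carrier := K\<rparr>"] by auto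
  then show ?thesis
    by (auto simp add: K.normal_inv_iff m_inv_consistent[OF K])
qed

lemma BijGroup_apply_mult:
  assumes "g \<in> carrier (BijGroup X)" "h \<in> carrier (BijGroup X)" "y \<in> X"
  shows "(g \<otimes>\<^bsub>BijGroup X\<^esub> h) y = g (h y)"
  using assms by (simp add: BijGroup_def compose_def)

lemma BijGroup_apply_closed:
  assumes "g \<in> carrier (BijGroup X)" "y \<in> X"
  shows "g y \<in> X"
  using assms Bij_imp_funcset by (fastforce simp: BijGroup_def)

lemma BijGroup_apply_eq_iff:
  assumes "g \<in> carrier (BijGroup X)" "y \<in> X" "z \<in> X"
  shows "g y = g z \<longleftrightarrow> y = z"
  using assms by (auto simp: BijGroup_def Bij_def bij_betw_def inj_on_def)

lemma BijGroup_apply_one: "y \<in> X \<Longrightarrow> \<one>\<^bsub>BijGroup X\<^esub> y = y"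
  by (simp add: BijGroup_def)

lemma BijGroup_apply_inv:
  assumes "g \<in> carrier (BijGroup X)" "y \<in> X"
  shows "(inv\<^bsub>BijGroup X\<^esub> g) (g y) = y" "g ((inv\<^bsub>BijGroup X\<^esub> g) y) = y"
proof -
  interpret group "BijGroup X" by (rule group_BijGroup)
  show "(inv\<^bsub>BijGroup X\<^esub> g) (g y) = y" "g ((inv\<^bsub>BijGroup X\<^esub> g) y) = y"
    using assms BijGroup_apply_mult[of "inv\<^bsub>BijGroup X\<^esub> g" X g y]
      BijGroup_apply_mult[of g X "inv\<^bsub>BijGroup X\<^esub> g" y]
    by (simp_all add: BijGroup_apply_one)
qed

lemma BijGroup_eqI:
  assumes "g \<in> carrier (BijGroup X)" "h \<in> carrier (BijGroup X)"
    and "\<And>y. y \<in> X \<Longrightarrow> g y = h y"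
  shows "g = h"
  using assms by (auto simp: BijGroup_def Bij_def intro: extensionalityI)

lemma subgroup_BijGroup_stabilizer:
  assumes H: "subgroup H (BijGroup X)" and x: "x \<in> X"
  shows "subgroup {h \<in> H. h x = x} (BijGroup X)"
proof -
  interpret group "BijGroup X" by (rule group_BijGroup)
  interpret H: subgroup H "BijGroup X" by (rule H)
  show ?thesis
  proof (rule subgroupI)
    show "{h \<in> H. h x = x} \<noteq> {}"
      using H.one_closed BijGroup_apply_one[OF x] by blast
    fix g assume g: "g \<in> {h \<in> H. h x = x}"
    then show "inv\<^bsub>BijGroup X\<^esub> g \<in> {h \<in> H. h x = x}"
      using BijGroup_apply_inv(1)[of g X x] x by auto
    fix h assume "h \<in> {h \<in> H. h x = x}"
    with g show "g \<otimes>\<^bsub>BijGroup X\<^esub> h \<in> {h \<in> H. h x = x}"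
      using BijGroup_apply_mult[of g X h x] x by auto
  qed auto
qed

section \<open>Groups of permutations whose point stabilizers are affine\<close>

text \<open>An abstract projective line: \<open>x\<close> is the point at infinity and
  \<open>P\<close> the affine coordinate on the rest. The assumption \<open>affine\<close> will come
  from \<open>H \<subseteq> PGL scale\<close>, the last two from
  \<open>PEL scale \<subseteq> H\<close>.\<close>

locale affine_permutations =
  fixes X :: "'x set" and x :: 'x and P :: "'d::division_ring \<Rightarrow> 'x" and H :: "('x \<Rightarrow> 'x) set"
  assumes subgroup_H: "subgroup H (BijGroup X)"
    and X_eq: "X = insert x (range P)"
    and inj_P: "inj P"
    and x_notin: "x \<notin> range P"
    and affine: "\<And>h. h \<in> H \<Longrightarrow> h x = x \<Longrightarrow>
      \<exists>\<alpha> \<beta> c. \<alpha> \<noteq> 0 \<and> \<beta> \<noteq> 0 \<and> (\<forall>t. h (P t) = P (\<alpha> * t * \<beta> + c))"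
    and ex_translation: "\<exists>h\<in>H. h x = x \<and> (\<forall>t. h (P t) = P (t + c))"
    and ex_sandwich: "\<alpha> \<noteq> 0 \<Longrightarrow> \<exists>h\<in>H. h x = x \<and> (\<forall>t. h (P t) = P (\<alpha> * t * \<alpha>))"
begin

abbreviation stab :: "('x \<Rightarrow> 'x) set" where
  "stab \<equiv> {h \<in> H. h x = x}"

text \<open>The choice is unambiguous, since an element of \<open>stab\<close> is determined by its
  values on \<open>range P\<close>, see \<open>stab_eqI\<close>.\<close>

definition translation :: "'d \<Rightarrow> 'x \<Rightarrow> 'x" where
  "translation c = (SOME h. h \<in> stab \<and> (\<forall>t. h (P t) = P (t + c)))"

abbreviation root_group :: "('x \<Rightarrow> 'x) set" where
  "root_group \<equiv> range translation"

abbreviation pmult (infixl "\<otimes>\<^sub>X" 70) where "g \<otimes>\<^sub>X h \<equiv> g \<otimes>\<^bsub>BijGroup X\<^esub> h"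
abbreviation pinv where "pinv g \<equiv> inv\<^bsub>BijGroup X\<^esub> g"

interpretation group "BijGroup X" by (rule group_BijGroup)

lemma x_in: "x \<in> X" and P_in: "P t \<in> X"
  by (auto simp: X_eq)

lemma minus_x: "X - {x} = range P"
  using X_eq x_notin by auto

lemma P_eq_iff: "P s = P t \<longleftrightarrow> s = t"
  using inj_P by (auto dest: injD)

lemma subgroup_stab: "subgroup stab (BijGroup X)"
  by (rule subgroup_BijGroup_stabilizer[OF subgroup_H x_in])

lemma stab_carrier: "h \<in> stab \<Longrightarrow> h \<in> carrier (BijGroup X)"
  using subgroup.subset[OF subgroup_stab] by blast

lemma stab_closed:
  assumes "g \<in> stab" "h \<in> stab"
  shows "g \<otimes>\<^sub>X h \<in> stab" "pinv g \<in> stab"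
  using subgroup.m_closed[OF subgroup_stab assms] subgroup.m_inv_closed[OF subgroup_stab assms(1)]
  by blast+

lemma apply_mult: "g \<in> stab \<Longrightarrow> h \<in> stab \<Longrightarrow> (g \<otimes>\<^sub>X h) (P t) = g (h (P t))"
  by (rule BijGroup_apply_mult[OF stab_carrier stab_carrier P_in])

lemma stab_eqI:
  assumes "g \<in> stab" "h \<in> stab" "\<And>t. g (P t) = h (P t)"
  shows "g = h"
  by (rule BijGroup_eqI[OF stab_carrier[OF assms(1)] stab_carrier[OF assms(2)]])
    (use assms in \<open>auto simp: X_eq\<close>)

text \<open>The premise compares \<open>g h\<close> with \<open>k g\<close>, so that no inverse has
  to be evaluated at a point.\<close>

lemma conj_eqI:
  assumes "g \<in> stab" "h \<in> stab" "k \<in> stab" "\<And>t. g (h (P t)) = k (g (P t))"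
  shows "g \<otimes>\<^sub>X h \<otimes>\<^sub>X pinv g = k"
proof -
  have "g \<otimes>\<^sub>X h = k \<otimes>\<^sub>X g"
    by (rule stab_eqI) (use assms stab_closed in \<open>simp_all only: apply_mult\<close>)
  then show ?thesis
    using assms by (simp add: inv_solve_right' stab_carrier)
qed

lemma normal_stab_iff:
  "N \<lhd> (BijGroup X)\<lparr>carrier := stab\<rparr> \<longleftrightarrow>
    subgroup N (BijGroup X) \<and> N \<subseteq> stab \<and> (\<forall>g\<in>stab. \<forall>h\<in>N. g \<otimes>\<^sub>X h \<otimes>\<^sub>X pinv g \<in> N)"
  by (rule normal_in_subgroup_iff[OF subgroup_stab])

section \<open>Translations and the root group\<close>

lemma translation_stab: "translation c \<in> stab"
  and translation_P: "translation c (P t) = P (t + c)"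
proof -
  have "\<exists>h. h \<in> stab \<and> (\<forall>t. h (P t) = P (t + c))"
    using ex_translation by blast
  from someI_ex[OF this] show "translation c \<in> stab" "translation c (P t) = P (t + c)"
    by (simp_all add: translation_def)
qed

lemma eq_translation:
  assumes "h \<in> stab" "\<And>t. h (P t) = P (t + c)"
  shows "h = translation c"
  by (rule stab_eqI) (simp_all add: assms translation_stab translation_P del: mem_Collect_eq)

text \<open>The constant \<open>c\<close> cancels: shifting the coordinate by \<open>d\<close>
  before applying \<open>g\<close> shifts the result by
  \<open>\<alpha> * d * \<beta>\<close>.\<close>

lemma conj_translation:
  assumes "g \<in> stab" "\<And>t. g (P t) = P (\<alpha> * t * \<beta> + c)"
  shows "g \<otimes>\<^sub>X translation d \<otimes>\<^sub>X pinv g = translation (\<alpha> * d * \<beta>)"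
  by (rule conj_eqI)
    (simp_all add: assms translation_stab translation_P distrib_left distrib_right add.assoc
      add.commute[of c] del: mem_Collect_eq)

lemma translation_diff: "translation (a - b) = translation a \<otimes>\<^sub>X pinv (translation b)"
proof -
  have "translation (a - b) \<otimes>\<^sub>X translation b = translation a"
    by (rule stab_eqI) (simp_all add: apply_mult translation_stab translation_P
      stab_closed del: mem_Collect_eq)
  then show ?thesis
    using stab_carrier[OF translation_stab] by (subst inv_solve_right) auto
qed

lemma root_group_normal: "root_group \<lhd> (BijGroup X)\<lparr>carrier := stab\<rparr>"
  unfolding normal_stab_iff
proof (intro conjI ballI)
  show "root_group \<subseteq> stab" using translation_stab by blast
  \<comment> \<open>The identity \<open>translation_diff\<close> yields all homomorphism laws,
    through \<open>0 - 0\<close>, \<open>0 - a\<close> and \<open>a - (- b)\<close>.\<close>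
  have one: "translation 0 = \<one>\<^bsub>BijGroup X\<^esub>"
    using translation_diff[of 0 0] stab_carrier[OF translation_stab[of 0]] by simp
  have minus: "translation (- a) = pinv (translation a)" for a
    using translation_diff[of 0 a] stab_carrier[OF translation_stab[of a]] by (simp add: one)
  have plus: "translation (a + b) = translation a \<otimes>\<^sub>X translation b" for a b
    using translation_diff[of a "- b"] stab_carrier[OF translation_stab[of b]] by (simp add: minus)
  show "subgroup root_group (BijGroup X)"
  proof (rule subgroupI)
    show "root_group \<subseteq> carrier (BijGroup X)" "root_group \<noteq> {}"
      using translation_stab stab_carrier by blast+
  next
    fix g h assume "g \<in> root_group" "h \<in> root_group"
    then obtain a b where ab: "g = translation a" "h = translation b" by blast
    show "g \<otimes>\<^sub>X h \<in> root_group" unfolding ab plus[symmetric] by (rule rangeI)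
    show "pinv g \<in> root_group" unfolding ab minus[symmetric] by (rule rangeI)
  qed
  fix g h assume g: "g \<in> stab" and "h \<in> root_group"
  then obtain d where h: "h = translation d" by blast
  obtain \<alpha> \<beta> c where "\<And>t. g (P t) = P (\<alpha> * t * \<beta> + c)"
    using affine g by blast
  then have "g \<otimes>\<^sub>X h \<otimes>\<^sub>X pinv g = translation (\<alpha> * d * \<beta>)"
    unfolding h by (rule conj_translation[OF g])
  then show "g \<otimes>\<^sub>X h \<otimes>\<^sub>X pinv g \<in> root_group" by simp
qed

lemma root_group_regular: "acts_regularly (\<lambda>h. h) root_group (X - {x})"
  unfolding acts_regularly_def minus_x
proof (intro conjI ballI)
  fix u y assume "u \<in> root_group" "y \<in> range P"
  then show "u y \<in> range P" by (auto simp: translation_P)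
next
  fix y z assume "y \<in> range P" "z \<in> range P"
  then obtain s t where st: "y = P s" "z = P t" by auto
  \<comment> \<open>The single solution \<open>c = t - s\<close> gives both existence and
    uniqueness.\<close>
  have iff: "translation c y = z \<longleftrightarrow> c = t - s" for c
    by (simp add: st translation_P P_eq_iff eq_diff_eq add.commute)
  show "\<exists>!u. u \<in> root_group \<and> u y = z"
  proof (rule ex1I)
    show "translation (t - s) \<in> root_group \<and> translation (t - s) y = z" by (simp add: iff)
    fix u assume "u \<in> root_group \<and> u y = z"
    then obtain c where "u = translation c" "translation c y = z" by auto
    then show "u = translation (t - s)" by (simp only: iff)
  qed
qed

section \<open>Uniqueness of the normal regular subgroup\<close>

lemma regular_subset_eq:
  assumes U: "acts_regularly (\<lambda>h. h) U (X - {x})" and V: "acts_regularly (\<lambda>h. h) V (X - {x})"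
    and "U \<subseteq> V"
  shows "U = V"
proof
  show "V \<subseteq> U"
  proof
    fix v assume v: "v \<in> V"
    have P0: "P 0 \<in> X - {x}" by (simp add: minus_x)
    then have vP0: "v (P 0) \<in> X - {x}" using V v by (simp add: acts_regularly_def)
    \<comment> \<open>The element of \<open>U\<close> that agrees with \<open>v\<close> at
      \<open>P 0\<close> also lies in \<open>V\<close>, so regularity of \<open>V\<close> identifies
      the two.\<close>
    from U P0 this have "\<exists>!u. u \<in> U \<and> u (P 0) = v (P 0)"
      by (simp add: acts_regularly_def)
    then obtain u where u: "u \<in> U" "u (P 0) = v (P 0)" by (elim ex1E conjE)
    from V P0 vP0 have "\<exists>!u. u \<in> V \<and> u (P 0) = v (P 0)"
      by (simp add: acts_regularly_def)
    moreover have "u \<in> V" using u(1) \<open>U \<subseteq> V\<close> by (rule subsetD[rotated])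
    ultimately have "u = v" using u(2) v by (elim ex1E) metis
    then show "v \<in> U" using u by simp
  qed
qed (rule \<open>U \<subseteq> V\<close>)

lemma normal_regular_eq_root_group:
  assumes N: "N \<lhd> (BijGroup X)\<lparr>carrier := stab\<rparr>"
    and reg: "acts_regularly (\<lambda>h. h) N (X - {x})"
  shows "N = root_group"
proof -
  have N_sub: "subgroup N (BijGroup X)" and N_stab: "N \<subseteq> stab"
    and N_conj: "\<And>g h. g \<in> stab \<Longrightarrow> h \<in> N \<Longrightarrow> g \<otimes>\<^sub>X h \<otimes>\<^sub>X pinv g \<in> N"
    using N unfolding normal_stab_iff by blast+
  interpret N: subgroup N "BijGroup X" by (rule N_sub)
  show ?thesis
  proof (cases "N \<subseteq> root_group")
    case True
    then show ?thesis by (rule regular_subset_eq[OF reg root_group_regular])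
  next
    case False
    then obtain n where n: "n \<in> N" "n \<notin> root_group" by blast
    then have n_stab: "n \<in> stab" using N_stab by blast
    then obtain \<alpha> \<beta> c where n_P: "\<And>t. n (P t) = P (\<alpha> * t * \<beta> + c)"
      using affine by blast
    \<comment> \<open>A stabilizer element with trivial linear part is a translation, and
      \<open>n\<close> is not one.\<close>
    obtain t0 where t0: "\<alpha> * t0 * \<beta> \<noteq> t0"
    proof (rule ccontr)
      assume "\<not> thesis"
      then have "\<alpha> * t * \<beta> = t" for t using that by blast
      then have "n = translation c" using n_stab by (intro eq_translation) (simp_all add: n_P)
      then show False using n(2) by blast
    qed
    define A where "A = {a. translation a \<in> N}"
    have diff: "a - b \<in> A" if "a \<in> A" "b \<in> A" for a b
      using that by (simp add: A_def translation_diff)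
    have comm: "\<alpha> * d * \<beta> - d \<in> A" for d
    proof -
      \<comment> \<open>The commutator of \<open>n\<close> with a translation is again a
        translation. Regrouped as \<open>n\<close> times a conjugate of \<open>pinv n\<close>, it
        lies in \<open>N\<close>.\<close>
      have "translation (\<alpha> * d * \<beta> - d) =
          n \<otimes>\<^sub>X translation d \<otimes>\<^sub>X pinv n \<otimes>\<^sub>X pinv (translation d)"
        by (simp only: translation_diff conj_translation[OF n_stab n_P])
      also have "\<dots> = n \<otimes>\<^sub>X (translation d \<otimes>\<^sub>X pinv n \<otimes>\<^sub>X pinv (translation d))"
        using stab_carrier[OF translation_stab] stab_carrier[OF n_stab] by (simp add: m_assoc)
      also have "\<dots> \<in> N"
        by (intro N.m_closed n(1) N_conj translation_stab N.m_inv_closed)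
      finally show ?thesis by (simp add: A_def)
    qed
    have sandwich: "s * a * s \<in> A" if a: "a \<in> A" for a s
    proof (cases "s = 0")
      case True
      then show ?thesis using diff[OF a a] by simp
    next
      case False
      then obtain h where h: "h \<in> stab" "\<And>t. h (P t) = P (s * t * s)"
        using ex_sandwich by blast
      \<comment> \<open>Conjugation by \<open>h\<close> turns normality of \<open>N\<close> into
        sandwich closure of \<open>A\<close>.\<close>
      have "h \<otimes>\<^sub>X translation a \<otimes>\<^sub>X pinv h = translation (s * a * s)"
        by (rule conj_translation[OF h(1), where c = 0]) (simp add: h(2))
      then show ?thesis using N_conj[OF h(1), of "translation a"] a by (simp add: A_def)
    qed
    have "A = UNIV"
    proof (cases "\<exists>p q :: 'd. p * q \<noteq> q * p")
      case True
      then obtain p q :: 'd where pq: "p * q \<noteq> q * p" by blast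
      \<comment> \<open>By \<open>comm\<close> at \<open>t0\<close>, this is the nonzero element of
        \<open>A\<close> that the sandwich lemma requires.\<close>
      have "\<alpha> * t0 * \<beta> - t0 \<noteq> 0" using t0 by simp
      from additive_subgroup_eq_UNIV_if_sandwich_closed[OF diff sandwich comm this pq]
      show ?thesis .
    next
      case False
      then have commute: "p * q = q * p" for p q :: 'd by blast
      \<comment> \<open>With commuting scalars the commutators give all multiples of
        \<open>\<mu>\<close>. It is nonzero by the choice of \<open>t0\<close>, so these exhaust the
        field.\<close>
      define \<mu> where "\<mu> = \<alpha> * \<beta> - 1"
      have scaled: "\<alpha> * d * \<beta> - d = \<mu> * d" for d
        using commute[of d \<beta>] by (simp add: \<mu>_def left_diff_distrib mult.assoc)
      have "\<mu> \<noteq> 0" using t0 scaled[of t0] by auto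
      then have "\<mu> * (inverse \<mu> * a) = a" for a by (simp add: mult.assoc[symmetric])
      then have "a \<in> A" for a using comm[of "inverse \<mu> * a"] by (simp only: scaled)
      then show ?thesis by blast
    qed
    then have "root_group \<subseteq> N" by (auto simp: A_def)
    then show ?thesis using regular_subset_eq[OF root_group_regular reg] by simp
  qed
qed

theorem ex1_normal_regular:
  "\<exists>!U. U \<lhd> (BijGroup X)\<lparr>carrier := stab\<rparr> \<and> acts_regularly (\<lambda>h. h) U (X - {x})"
  by (rule ex1I[of _ root_group])
    (simp_all add: root_group_normal root_group_regular normal_regular_eq_root_group)

end

section \<open>Lines in a plane\<close>

context right_vector_space
begin

lemma scale_zero_right [simp]: "scale v 0 = 0"
  using scale_add_right[of v 0 0] by simp

lemma scale_zero_left [simp]: "scale 0 a = 0"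
  using scale_add_left[of 0 0 a] by simp

lemma scale_eq_0_iff: "scale v a = 0 \<longleftrightarrow> v = 0 \<or> a = 0"
  by (metis right_inverse scale_one scale_scale scale_zero_left scale_zero_right)

lemma scale_minus_right: "scale v (- a) = - scale v a"
  by (metis scale_add_right scale_zero_right add.right_inverse minus_unique)

lemma scale_diff_right: "scale v (a - b) = scale v a - scale v b"
  using scale_add_right[of v a "- b"] by (simp add: scale_minus_right)

lemma range_scale_scale: "a \<noteq> 0 \<Longrightarrow> range (scale (scale v a)) = range (scale v)"
proof (intro equalityI subsetI)
  fix w assume "a \<noteq> 0" "w \<in> range (scale v)"
  then obtain b where "w = scale v (a * (inverse a * b))"
    by (auto simp: mult.assoc[symmetric])
  then show "w \<in> range (scale (scale v a))" by (auto simp: scale_scale)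
qed (auto simp: scale_scale)

text \<open>A basis of size one is a single nonzero vector. Lines can from here on be handled
  through spanning vectors.\<close>

lemma Gr_1_iff: "L \<in> Gr scale 1 \<longleftrightarrow> (\<exists>v. v \<noteq> 0 \<and> L = range (scale v))"
proof -
  have span: "{\<Sum>w\<in>F. scale w (c w) | F c. finite F \<and> F \<subseteq> {v}} = range (scale v)" for v
  proof (intro equalityI subsetI)
    fix u assume "u \<in> {\<Sum>w\<in>F. scale w (c w) | F c. finite F \<and> F \<subseteq> {v}}"
    then obtain F c where "F \<subseteq> {v}" "u = (\<Sum>w\<in>F. scale w (c w))" by blast
    \<comment> \<open>\<open>F\<close> is empty or \<open>{v}\<close>, and the empty sum is
      \<open>scale v 0\<close>.\<close>
    then have "u = scale v 0 \<or> u = scale v (c v)" by (auto simp: subset_singleton_iff)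
    then show "u \<in> range (scale v)" by blast
  next
    fix u assume "u \<in> range (scale v)"
    then obtain a where "u = scale v a" by blast
    then show "u \<in> {\<Sum>w\<in>F. scale w (c w) | F c. finite F \<and> F \<subseteq> {v}}"
      by (intro CollectI exI[of _ "{v}"] exI[of _ "\<lambda>_. a"]) simp
  qed
  have basis: "is_basis_of scale L {v} \<longleftrightarrow> v \<noteq> 0 \<and> L = range (scale v)" for v
  proof -
    have "(\<forall>c. \<forall>F\<subseteq>{v}. finite F \<longrightarrow> (\<Sum>w\<in>F. scale w (c w)) = 0 \<longrightarrow> (\<forall>w\<in>F. c w = 0)) \<longleftrightarrow> v \<noteq> 0"
      (is "?indep \<longleftrightarrow> _")
    proof
      assume indep: ?indep
      show "v \<noteq> 0"
        using indep[rule_format, of "{v}" "\<lambda>_. 1" v] by auto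
    qed (auto simp: subset_singleton_iff scale_eq_0_iff)
    then show ?thesis unfolding is_basis_of_def span by simp
  qed
  have dim: "has_dimension scale L 1 \<longleftrightarrow> (\<exists>v. is_basis_of scale L {v})"
  proof
    assume "has_dimension scale L 1"
    then show "\<exists>v. is_basis_of scale L {v}"
      unfolding has_dimension_def by (elim exE conjE card_1_singletonE) auto
  next
    assume "\<exists>v. is_basis_of scale L {v}"
    then obtain v where "is_basis_of scale L {v}" ..
    then show "has_dimension scale L 1"
      unfolding has_dimension_def by (intro exI[of _ "{v}"]) simp
  qed
  have "right_subspace scale (range (scale v))" for v
    unfolding right_subspace_def
  proof (intro conjI ballI allI)
    show "0 \<in> range (scale v)" by (rule range_eqI[of _ _ 0]) simp
  qed (auto simp: scale_scale scale_add_right[symmetric])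
  then show ?thesis unfolding Gr_def mem_Collect_eq dim basis by auto
qed

end

text \<open>An ordered basis of a plane: \<open>e\<close> will span the distinguished line, and
  \<open>f\<close> the line with affine coordinate 0.\<close>

locale frame = right_vector_space scale
  for scale :: "'v::ab_group_add \<Rightarrow> 'd::division_ring \<Rightarrow> 'v" (infixl "\<cdot>" 75) +
  fixes e f :: 'v
  assumes span: "\<exists>a b. v = e \<cdot> a + f \<cdot> b"
    and indep: "e \<cdot> a + f \<cdot> b = 0 \<Longrightarrow> a = 0 \<and> b = 0"

lemma (in right_vector_space) frame_swap:
  assumes "frame scale e f"
  shows "frame scale f e"
proof -
  interpret frame scale e f by (rule assms)
  show ?thesis
  proof unfold_locales
    show "\<exists>a b. v = scale f a + scale e b" for v
      using span[of v] by (auto simp: add.commute)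
    show "a = 0 \<and> b = 0" if "scale f a + scale e b = 0" for a b
      using indep[of b a] that by (simp add: add.commute)
  qed
qed

lemma (in right_vector_space) ex_frame:
  assumes "has_dimension scale UNIV 2"
  shows "\<exists>e f. frame scale e f"
proof -
  obtain B where B: "card B = 2" "is_basis_of scale UNIV B"
    using assms by (auto simp: has_dimension_def)
  then obtain e f where ef: "B = {e, f}" "e \<noteq> f"
    by (auto simp: card_2_iff)
  have "frame scale e f"
  proof unfold_locales
    fix v
    obtain F c where F: "F \<subseteq> {e, f}" "v = (\<Sum>w\<in>F. scale w (c w))"
      using B(2) unfolding is_basis_of_def ef(1) by blast
    \<comment> \<open>Coefficients are padded with 0 outside \<open>F\<close>, so that the sum runs
      over the whole basis.\<close>
    define d where "d w = (if w \<in> F then c w else 0)" for w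
    have "v = (\<Sum>w\<in>{e, f}. scale w (d w))"
      unfolding F(2) by (rule sum.mono_neutral_cong_left) (use F(1) in \<open>auto simp: d_def\<close>)
    then have "v = scale e (d e) + scale f (d f)" using ef(2) by simp
    then show "\<exists>a b. v = scale e a + scale f b" by blast
  next
    fix a b assume ab: "scale e a + scale f b = 0"
    define c where "c w = (if w = e then a else b)" for w
    have "(\<Sum>w\<in>{e, f}. scale w (c w)) = 0" using ab ef(2) by (simp add: c_def)
    then have "\<forall>w\<in>{e, f}. c w = 0"
      using B(2) unfolding is_basis_of_def ef(1) by blast
    then show "a = 0 \<and> b = 0" using ef(2) by (simp add: c_def)
  qed
  then show ?thesis by blast
qed

context frame
begin

lemma frame_replace_first:
  assumes "p \<noteq> 0"
  shows "frame scale (e \<cdot> p + f \<cdot> q) f"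
proof unfold_locales
  fix v
  obtain a b where v: "v = e \<cdot> a + f \<cdot> b" using span by blast
  have "p * (inverse p * a) = a" using assms by (simp add: mult.assoc[symmetric])
  \<comment> \<open>The \<open>e\<close>-part forces the coefficient \<open>inverse p * a\<close>,
    and the coefficient of \<open>f\<close> absorbs the surplus.\<close>
  then have "v = (e \<cdot> p + f \<cdot> q) \<cdot> (inverse p * a) + f \<cdot> (b - q * (inverse p * a))"
    by (simp add: v scale_add_left scale_scale add.assoc flip: scale_add_right)
  then show "\<exists>a b. v = (e \<cdot> p + f \<cdot> q) \<cdot> a + f \<cdot> b" by blast
next
  fix a b assume "(e \<cdot> p + f \<cdot> q) \<cdot> a + f \<cdot> b = 0"
  then have "e \<cdot> (p * a) + f \<cdot> (q * a + b) = 0"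
    by (simp add: scale_add_left scale_scale scale_add_right add.assoc)
  from indep[OF this] show "a = 0 \<and> b = 0" using assms by auto
qed

text \<open>Exchange argument: \<open>v\<close> replaces a basis vector along which its coordinate
  is nonzero. Hence any line can serve as the distinguished one.\<close>

lemma ex_frame_through:
  assumes "v \<noteq> 0"
  shows "\<exists>w. frame scale v w"
proof -
  obtain a b where v: "v = e \<cdot> a + f \<cdot> b" using span by blast
  show ?thesis
  proof (cases "a = 0")
    case True
    then have "b \<noteq> 0" using assms v by auto
    then have "frame scale (f \<cdot> b + e \<cdot> a) e"
      by (rule frame.frame_replace_first[OF frame_swap[OF frame_axioms]])
    then show ?thesis unfolding v add.commute[of "e \<cdot> a"] ..
  next
    case False
    then have "frame scale v f" unfolding v by (rule frame_replace_first)
    then show ?thesis ..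
  qed
qed

section \<open>Coordinates with respect to a frame\<close>

definition coord_e :: "'v \<Rightarrow> 'd" where "coord_e v = (THE a. \<exists>b. v = e \<cdot> a + f \<cdot> b)"
definition coord_f :: "'v \<Rightarrow> 'd" where "coord_f v = (THE b. \<exists>a. v = e \<cdot> a + f \<cdot> b)"

lemma combination_eq_iff: "e \<cdot> a + f \<cdot> b = e \<cdot> a' + f \<cdot> b' \<longleftrightarrow> a = a' \<and> b = b'"
proof
  assume "e \<cdot> a + f \<cdot> b = e \<cdot> a' + f \<cdot> b'"
  then have "e \<cdot> (a - a') + f \<cdot> (b - b') = 0"
    by (simp add: scale_diff_right) (simp add: algebra_simps)
  from indep[OF this] show "a = a' \<and> b = b'" by simp
qed simp

lemma coord_combination [simp]:
  "coord_e (e \<cdot> a + f \<cdot> b) = a" "coord_f (e \<cdot> a + f \<cdot> b) = b"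
  by (auto simp: coord_e_def coord_f_def combination_eq_iff)

lemma combination_coord: "e \<cdot> coord_e v + f \<cdot> coord_f v = v"
  using span[of v] by auto

lemma coord_basis [simp]: "coord_e e = 1" "coord_f e = 0" "coord_e f = 0" "coord_f f = 1"
  using coord_combination[of 1 0] coord_combination[of 0 1] by (simp_all add: scale_one)

lemma combination_add: "(e \<cdot> a + f \<cdot> b) + (e \<cdot> a' + f \<cdot> b') = e \<cdot> (a + a') + f \<cdot> (b + b')"
  by (simp add: scale_add_right add_ac)

lemma combination_scale: "(e \<cdot> a + f \<cdot> b) \<cdot> c = e \<cdot> (a * c) + f \<cdot> (b * c)"
  by (simp add: scale_add_left scale_scale)

lemma coord_add: "coord_e (v + w) = coord_e v + coord_e w" "coord_f (v + w) = coord_f v + coord_f w"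
  by (metis combination_add combination_coord coord_combination)+

lemma coord_scale: "coord_e (v \<cdot> c) = coord_e v * c" "coord_f (v \<cdot> c) = coord_f v * c"
  by (metis combination_scale combination_coord coord_combination)+

section \<open>Affine coordinate on the lines\<close>

definition line_e :: "'v set" where "line_e = range (scale e)"
text \<open>The point with homogeneous coordinates \<open>(t : 1)\<close>, while
  \<open>line_e\<close> is \<open>(1 : 0)\<close>, the point at infinity.\<close>

definition affine_point :: "'d \<Rightarrow> 'v set" where "affine_point t = range (scale (e \<cdot> t + f))"

text \<open>Scalars act on the right, so normalizing the second coordinate to 1 multiplies the first
  by \<open>inverse b\<close> on the right.\<close>

lemma range_scale_combination:
  "b \<noteq> 0 \<Longrightarrow> range (scale (e \<cdot> a + f \<cdot> b)) = affine_point (a * inverse b)"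
  using range_scale_scale[of b "e \<cdot> (a * inverse b) + f"]
  by (simp add: affine_point_def scale_add_left scale_scale mult.assoc)

lemma combination_eq_0_iff: "e \<cdot> a + f \<cdot> b = 0 \<longleftrightarrow> a = 0 \<and> b = 0"
  using indep by auto

lemma e_nonzero: "e \<noteq> 0" and affine_point_vector_nonzero: "e \<cdot> t + f \<noteq> 0"
  using combination_eq_0_iff[of 1 0] combination_eq_0_iff[of t 1] by (simp_all add: scale_one)

lemma Gr_1_eq: "Gr scale 1 = insert line_e (range affine_point)"
proof (intro equalityI subsetI)
  fix L assume "L \<in> Gr scale 1"
  then obtain v where v: "v \<noteq> 0" "L = range (scale v)" unfolding Gr_1_iff by blast
  obtain a b where ab: "v = e \<cdot> a + f \<cdot> b" using span by blast
  show "L \<in> insert line_e (range affine_point)"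
  proof (cases "b = 0")
    case True
    then have "a \<noteq> 0" using v ab by auto
    then have "L = line_e" by (simp add: v(2) ab True line_e_def range_scale_scale)
    then show ?thesis by simp
  qed (use v ab range_scale_combination in auto)
next
  fix L assume "L \<in> insert line_e (range affine_point)"
  then show "L \<in> Gr scale 1"
    unfolding Gr_1_iff line_e_def affine_point_def
    using e_nonzero affine_point_vector_nonzero by blast
qed

lemma range_scale_self: "v \<in> range (scale v)"
  by (metis rangeI scale_one)

lemma affine_point_neq_line_e: "affine_point t \<noteq> line_e"
proof
  assume "affine_point t = line_e"
  then obtain a where "e \<cdot> t + f = e \<cdot> a"
    using range_scale_self[of "e \<cdot> t + f"] by (auto simp: affine_point_def line_e_def)
  then have "coord_f (e \<cdot> t + f \<cdot> 1) = coord_f (e \<cdot> a + f \<cdot> 0)" by (simp add: scale_one)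
  then show False unfolding coord_combination by simp
qed

lemma inj_affine_point: "inj affine_point"
proof (rule injI)
  fix s t assume "affine_point s = affine_point t"
  then obtain a where "e \<cdot> s + f = (e \<cdot> t + f) \<cdot> a"
    using range_scale_self[of "e \<cdot> s + f"] by (auto simp: affine_point_def)
  then have "e \<cdot> s + f \<cdot> 1 = e \<cdot> (t * a) + f \<cdot> a"
    by (simp add: scale_one scale_add_left scale_scale)
  then show "s = t" unfolding combination_eq_iff by auto
qed

lemma three_lines: "infinite (Gr scale 1) \<or> card (Gr scale 1) \<ge> 3"
proof -
  have "card {line_e, affine_point 0, affine_point 1} = 3"
    using affine_point_neq_line_e inj_affine_point
    by (auto simp: card_insert_if dest: injD)
  moreover have "{line_e, affine_point 0, affine_point 1} \<subseteq> Gr scale 1"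
    unfolding Gr_1_eq by blast
  ultimately show ?thesis
    using card_mono[of "Gr scale 1" "{line_e, affine_point 0, affine_point 1}"] by auto
qed

end

section \<open>Induced permutations of the lines\<close>

text \<open>Composition matches the product in \<open>BijGroup\<close>. That \<open>h\<close> maps
  lines to lines is read off from its induced map lying in \<open>H\<close>, and off the set of
  lines both sides are undefined.\<close>

lemma induced_on_lines_comp_in_subgroup:
  assumes H: "subgroup H (BijGroup (Gr scale 1))"
    and g: "induced_on_lines scale g \<in> H" and h: "induced_on_lines scale h \<in> H"
  shows "induced_on_lines scale (g \<circ> h) \<in> H"
proof -
  let ?X = "Gr scale 1"
  let ?m = "induced_on_lines scale g \<otimes>\<^bsub>BijGroup ?X\<^esub> induced_on_lines scale h"
  have m: "?m \<in> H" by (rule subgroup.m_closed[OF H g h])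
  note carrier = subsetD[OF subgroup.subset[OF H]]
  have "induced_on_lines scale (g \<circ> h) L = ?m L" for L
  proof (cases "L \<in> ?X")
    case True
    have "induced_on_lines scale h L \<in> ?X"
      by (rule BijGroup_apply_closed[OF carrier[OF h] True])
    then have "h ` L \<in> ?X" using True by (simp add: induced_on_lines_def)
    moreover have "?m L = induced_on_lines scale g (induced_on_lines scale h L)"
      by (rule BijGroup_apply_mult[OF carrier[OF g] carrier[OF h] True])
    ultimately show ?thesis
      using True by (simp add: induced_on_lines_def image_comp)
  next
    case False
    have "?m \<in> extensional ?X" using carrier[OF m] by (simp add: BijGroup_def Bij_def)
    from extensional_arb[OF this False] show ?thesis
      using False by (simp add: induced_on_lines_def)
  qed
  then have "induced_on_lines scale (g \<circ> h) = ?m" ..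
  then show ?thesis using m by simp
qed

locale projective_line_group = frame +
  fixes H :: "('a set \<Rightarrow> 'a set) set"
  assumes subgroup_H: "subgroup H (BijGroup (Gr scale 1))"
    and PEL_subset: "PEL scale \<subseteq> H"
    and H_subset: "H \<subseteq> PGL scale"
begin

section \<open>Permutations supplied by transvections\<close>

lemma transvection_in:
  assumes "right_linear scale (*) \<rho>" "\<rho> u = 0"
  shows "induced_on_lines scale (\<lambda>v. v + scale u (\<rho> v)) \<in> H"
proof -
  have "(\<lambda>v. v + scale u (\<rho> v)) \<in> EL scale"
    unfolding EL_def by (rule generate.incl) (use assms in \<open>auto simp: transvections_def\<close>)
  then show ?thesis using PEL_subset by (auto simp: PEL_def)
qed

text \<open>Elementary matrices \<open>(1, a; 0, 1)\<close> and, for \<open>shear_f\<close>,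
  \<open>(1, 0; a, 1)\<close> on coordinate columns. The factor \<open>a\<close> stands on the left
  of the coordinate, which keeps the form right linear.\<close>

definition shear_e :: "'b \<Rightarrow> 'a \<Rightarrow> 'a" where "shear_e a v = v + e \<cdot> (a * coord_f v)"
definition shear_f :: "'b \<Rightarrow> 'a \<Rightarrow> 'a" where "shear_f a v = v + f \<cdot> (a * coord_e v)"

lemma shear_combination:
  "shear_e a (e \<cdot> p + f \<cdot> q) = e \<cdot> (p + a * q) + f \<cdot> q"
  "shear_f a (e \<cdot> p + f \<cdot> q) = e \<cdot> p + f \<cdot> (q + a * p)"
  by (simp_all add: shear_e_def shear_f_def scale_add_right add_ac)

lemma shear_in: "induced_on_lines scale (shear_e a) \<in> H" "induced_on_lines scale (shear_f a) \<in> H"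
  unfolding shear_e_def[abs_def] shear_f_def[abs_def]
  by (rule transvection_in;
      simp add: right_linear_def coord_add coord_scale distrib_left mult.assoc)+

lemma induced_apply:
  assumes "\<And>v c. g (v \<cdot> c) = g v \<cdot> c" "v \<noteq> 0"
  shows "induced_on_lines scale g (range (scale v)) = range (scale (g v))"
proof -
  have "range (scale v) \<in> Gr scale 1" using assms(2) unfolding Gr_1_iff by blast
  then show ?thesis
    using assms(1) by (simp add: induced_on_lines_def image_image)
qed

lemma ex_translation:
  "\<exists>h\<in>H. h line_e = line_e \<and> (\<forall>t. h (affine_point t) = affine_point (t + c))"
proof (intro bexI conjI allI)
  have hom: "shear_e c (v \<cdot> a) = shear_e c v \<cdot> a" for v a
    by (simp add: shear_e_def coord_scale scale_add_left scale_scale mult.assoc)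
  show "induced_on_lines scale (shear_e c) line_e = line_e"
    unfolding line_e_def induced_apply[OF hom e_nonzero] by (simp add: shear_e_def)
  show "induced_on_lines scale (shear_e c) (affine_point t) = affine_point (t + c)" for t
    unfolding affine_point_def induced_apply[OF hom affine_point_vector_nonzero]
    using shear_combination(1)[of c t 1] by (simp add: scale_one)
qed (rule shear_in)

text \<open>The diagonal map with entries \<open>\<alpha>\<close> and
  \<open>inverse \<alpha>\<close> sends \<open>(t : 1)\<close> to
  \<open>(\<alpha> * t : inverse \<alpha>)\<close>, which normalizes to
  \<open>\<alpha> * t * \<alpha>\<close>. It is a product of shears.\<close>

lemma ex_sandwich:
  assumes "\<alpha> \<noteq> 0"
  shows "\<exists>h\<in>H. h line_e = line_e \<and> (\<forall>t. h (affine_point t) = affine_point (\<alpha> * t * \<alpha>))"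
proof (intro bexI conjI allI)
  define w where "w a = shear_e a \<circ> (shear_f (- inverse a) \<circ> shear_e a)" for a
  txt \<open>\<open>w a\<close> has the matrix \<open>(0, a; -a\<^sup>-\<^sup>1, 0)\<close>, so \<open>w \<alpha> \<circ> w (-1)\<close> is diagonal with entries \<open>\<alpha>, \<alpha>\<^sup>-\<^sup>1\<close>.\<close>
  have w: "w a (e \<cdot> p + f \<cdot> q) = e \<cdot> (a * q) + f \<cdot> (- inverse a * p)" if "a \<noteq> 0" for a p q
    using that by (simp add: w_def shear_combination distrib_left mult.assoc[symmetric])
  define g where "g = w \<alpha> \<circ> w (- 1)"
  have g: "g (e \<cdot> p + f \<cdot> q) = e \<cdot> (\<alpha> * p) + f \<cdot> (inverse \<alpha> * q)" for p q
    using assms by (simp add: g_def w)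
  show "induced_on_lines scale g \<in> H"
    unfolding g_def w_def
    by (intro induced_on_lines_comp_in_subgroup[OF subgroup_H] shear_in)
  have hom: "g (v \<cdot> c) = g v \<cdot> c" for v c
  proof -
    obtain a b where v: "v = e \<cdot> a + f \<cdot> b" using span by blast
    show ?thesis unfolding v combination_scale g by (simp only: mult.assoc)
  qed
  have "g e = e \<cdot> \<alpha>" using g[of 1 0] by (simp add: scale_one)
  then show "induced_on_lines scale g line_e = line_e"
    unfolding line_e_def induced_apply[OF hom e_nonzero] by (simp add: range_scale_scale assms)
  fix t
  have "g (e \<cdot> t + f) = e \<cdot> (\<alpha> * t) + f \<cdot> inverse \<alpha>"
    using g[of t 1] by (simp add: scale_one)
  then have "induced_on_lines scale g (affine_point t) = range (scale (e \<cdot> (\<alpha> * t) + f \<cdot> inverse \<alpha>))"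
    unfolding affine_point_def induced_apply[OF hom affine_point_vector_nonzero] by simp
  also have "\<dots> = affine_point (\<alpha> * t * \<alpha>)"
    using assms by (simp add: range_scale_combination)
  finally show "induced_on_lines scale g (affine_point t) = affine_point (\<alpha> * t * \<alpha>)" .
qed

text \<open>A linear map inducing \<open>h\<close> has an upper triangular matrix
  \<open>(\<alpha>, \<beta>; 0, \<delta>)\<close> and sends \<open>(t : 1)\<close> to
  \<open>(\<alpha> * t + \<beta> : \<delta>)\<close>. Normalizing gives the right factor
  \<open>inverse \<delta>\<close> and the constant
  \<open>\<beta> * inverse \<delta>\<close>.\<close>

lemma affine_on_stabilizer:
  assumes h: "h \<in> H" "h line_e = line_e"
  shows "\<exists>\<alpha> \<beta> c. \<alpha> \<noteq> 0 \<and> \<beta> \<noteq> 0 \<and> (\<forall>t. h (affine_point t) = affine_point (\<alpha> * t * \<beta> + c))"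
proof -
  obtain g where g: "bij g" "right_linear scale scale g" and h_g: "h = induced_on_lines scale g"
    using h(1) H_subset by (auto simp: PGL_def GL_def)
  have g_add: "g (v + w) = g v + g w" and hom: "g (v \<cdot> c) = g v \<cdot> c" for v w c
    using g(2) by (auto simp: right_linear_def)
  have inj: "g v = g w \<longleftrightarrow> v = w" for v w
    using g(1) by (auto dest: bij_is_inj injD)
  have "range (scale (g e)) = range (scale e)"
    using h(2) unfolding h_g line_e_def induced_apply[OF hom e_nonzero] .
  then obtain \<alpha> where \<alpha>: "g e = e \<cdot> \<alpha>" using range_scale_self[of "g e"] by auto
  have "g 0 = 0" using hom[of 0 0] by simp
  then have "\<alpha> \<noteq> 0" using \<alpha> inj[of e 0] e_nonzero by auto
  obtain \<beta> \<delta> where \<delta>: "g f = e \<cdot> \<beta> + f \<cdot> \<delta>" using span by blast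
  \<comment> \<open>Otherwise \<open>f\<close> and a multiple of \<open>e\<close> would have the
    same image under the injective \<open>g\<close>.\<close>
  have "\<delta> \<noteq> 0"
  proof
    assume "\<delta> = 0"
    then have "g f = g (e \<cdot> (inverse \<alpha> * \<beta>))"
      using \<open>\<alpha> \<noteq> 0\<close> by (simp add: \<delta> hom \<alpha> scale_scale mult.assoc[symmetric])
    then have "coord_f f = coord_f (e \<cdot> (inverse \<alpha> * \<beta>) + f \<cdot> 0)" by (simp add: inj)
    then show False unfolding coord_combination by simp
  qed
  have "h (affine_point t) = affine_point (\<alpha> * t * inverse \<delta> + \<beta> * inverse \<delta>)" for t
  proof -
    have "g (e \<cdot> t + f) = e \<cdot> (\<alpha> * t + \<beta>) + f \<cdot> \<delta>"
      by (simp add: g_add hom \<alpha> \<delta> scale_scale scale_add_right add.assoc)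
    then have "h (affine_point t) = range (scale (e \<cdot> (\<alpha> * t + \<beta>) + f \<cdot> \<delta>))"
      unfolding h_g affine_point_def induced_apply[OF hom affine_point_vector_nonzero] by simp
    then show ?thesis
      using \<open>\<delta> \<noteq> 0\<close> by (simp add: range_scale_combination distrib_right)
  qed
  moreover have "inverse \<delta> \<noteq> 0" using \<open>\<delta> \<noteq> 0\<close> by simp
  ultimately show ?thesis using \<open>\<alpha> \<noteq> 0\<close> by blast
qed

sublocale affine_permutations "Gr scale 1" line_e affine_point H
proof (rule affine_permutations.intro)
  show "line_e \<notin> range affine_point"
    using affine_point_neq_line_e by fastforce
qed (fact subgroup_H Gr_1_eq inj_affine_point affine_on_stabilizer ex_translation ex_sandwich)+

end

section \<open>Moufang sets\<close>

lemma stabilizer_group_permutation_group: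
  "stabilizer_group (permutation_group X H) (\<lambda>h. h) x = (BijGroup X)\<lparr>carrier := {h \<in> H. h x = x}\<rparr>"
  by (simp add: stabilizer_def)

text \<open>Two-transitivity is derived: the regular subgroups make every point stabilizer
  transitive on the remaining points, and a third point lets these stabilizers be combined.\<close>

lemma unique_moufang_set_permutation_group:
  assumes H: "subgroup H (BijGroup X)"
    and three: "infinite X \<or> card X \<ge> 3"
    and ex1: "\<And>x. x \<in> X \<Longrightarrow> \<exists>!U. U \<lhd> stabilizer_group (permutation_group X H) (\<lambda>h. h) x \<and>
      acts_regularly (\<lambda>h. h) U (X - {x})"
  shows "unique_moufang_set (permutation_group X H) (\<lambda>h. h) X"
proof -
  interpret group "BijGroup X" by (rule group_BijGroup)
  interpret H: subgroup H "BijGroup X" by (rule H)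
  let ?G = "permutation_group X H"
  let ?S = "\<lambda>x. stabilizer_group ?G (\<lambda>h. h) x"
  have third: "\<exists>w\<in>X. w \<noteq> y \<and> w \<noteq> z" for y z
  proof (rule ccontr)
    assume "\<not> ?thesis"
    then have "X \<subseteq> {y, z}" by blast
    moreover from this have "finite X" by (rule finite_subset) simp
    ultimately have "card X \<le> 2"
      using card_mono[of "{y, z}" X] card_insert_le_m1[of 2 "{z}" y] by simp
    with \<open>finite X\<close> three show False by simp
  qed
  have normal_iff: "U \<lhd> ?S x \<longleftrightarrow> subgroup U (BijGroup X) \<and> U \<subseteq> {h \<in> H. h x = x} \<and>
      (\<forall>g\<in>{h \<in> H. h x = x}. \<forall>h\<in>U. g \<otimes>\<^bsub>BijGroup X\<^esub> h \<otimes>\<^bsub>BijGroup X\<^esub> inv\<^bsub>BijGroup X\<^esub> g \<in> U)"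
    if "x \<in> X" for U x
    unfolding stabilizer_group_permutation_group
    by (rule normal_in_subgroup_iff[OF subgroup_BijGroup_stabilizer[OF H that]])
  have move: "\<exists>h\<in>H. h x = x \<and> h y = z"
    if "x \<in> X" "y \<in> X - {x}" "z \<in> X - {x}" for x y z
  proof -
    from ex1[OF that(1)] obtain U where U: "U \<lhd> ?S x" "acts_regularly (\<lambda>h. h) U (X - {x})"
      by (elim ex1E conjE)
    from U(2) that(2,3) have "\<exists>!u. u \<in> U \<and> u y = z" by (simp add: acts_regularly_def)
    then obtain u where "u \<in> U" "u y = z" by (elim ex1E conjE)
    moreover have "U \<subseteq> {h \<in> H. h x = x}" using U(1) normal_iff[OF that(1)] by blast
    ultimately show ?thesis by blast
  qed
  have trans: "two_transitive ?G (\<lambda>h. h) X"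
    unfolding two_transitive_def
  proof (intro ballI impI)
    fix x y x' y' assume mem: "x \<in> X" "y \<in> X" "x' \<in> X" "y' \<in> X" and neq: "x \<noteq> y" "x' \<noteq> y'"
    \<comment> \<open>An element fixing a third point \<open>w\<close> takes \<open>x\<close> to
      \<open>x'\<close>, and then one fixing \<open>x'\<close> corrects the image of
      \<open>y\<close>.\<close>
    obtain w where w: "w \<in> X" "w \<noteq> x" "w \<noteq> x'" using third by blast
    obtain g where g: "g \<in> H" "g x = x'"
      using move[of w x x'] w mem by blast
    have "g y \<in> X - {x'}"
      using BijGroup_apply_closed[of g X y] BijGroup_apply_eq_iff[of g X y x] g mem neq by auto
    then obtain h where h: "h \<in> H" "h x' = x'" "h (g y) = y'"
      using move[of x' "g y" y'] mem neq by blast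
    show "\<exists>k\<in>carrier ?G. k x = x' \<and> k y = y'"
      using g h mem by (intro bexI[of _ "h \<otimes>\<^bsub>BijGroup X\<^esub> g"]) (simp_all add: BijGroup_apply_mult)
  qed
  have action: "group_action ?G X (\<lambda>h. h)"
    using subgroup_imp_group[OF H] group_BijGroup
    by (auto simp: group_action_def group_hom_def group_hom_axioms_def hom_def)
  show ?thesis
    unfolding unique_moufang_set_def
  proof
    fix x assume x: "x \<in> X"
    from ex1[OF x] obtain U where U: "U \<lhd> ?S x" "acts_regularly (\<lambda>h. h) U (X - {x})"
      and unique: "\<And>V. V \<lhd> ?S x \<Longrightarrow> acts_regularly (\<lambda>h. h) V (X - {x}) \<Longrightarrow> V = U"
      by (elim ex1E conjE) blast
    have fixed: "u x = x" if "u \<in> U" for u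
      using U(1) that normal_iff[OF x] by blast
    have "U \<subseteq> H" "subgroup U (BijGroup X)" using U(1) normal_iff[OF x] by blast+
    then have "subgroup U ?G" by (intro subgroup_incl H)
    show "\<exists>!U. moufang_set ?G (\<lambda>h. h) U X \<and> (\<forall>u\<in>U. u x = x)"
    proof (rule ex1I)
      show "moufang_set ?G (\<lambda>h. h) U X \<and> (\<forall>u\<in>U. u x = x)"
        unfolding moufang_set_def
        using action three trans \<open>subgroup U ?G\<close> x U fixed by blast
    next
      fix V assume V: "moufang_set ?G (\<lambda>h. h) V X \<and> (\<forall>v\<in>V. v x = x)"
      then obtain y where y: "y \<in> X" "acts_regularly (\<lambda>h. h) V (X - {y})" "V \<lhd> ?S y"
        unfolding moufang_set_def by blast
      \<comment> \<open>The definition provides only some fixed point \<open>y\<close>. If it were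
        not \<open>x\<close>, regularity off \<open>y\<close> would move \<open>x\<close> to a third
        point \<open>z\<close>, although \<open>V\<close> fixes \<open>x\<close>.\<close>
      have "y = x"
      proof (rule ccontr)
        assume "y \<noteq> x"
        obtain z where "z \<in> X" "z \<noteq> x" "z \<noteq> y" using third by blast
        then have "\<exists>!v. v \<in> V \<and> v x = z"
          using y(2) x \<open>y \<noteq> x\<close> by (simp add: acts_regularly_def)
        then obtain v where "v \<in> V" "v x = z" by (elim ex1E conjE)
        then show False using V \<open>z \<noteq> x\<close> by auto
      qed
      with y show "V = U" by (intro unique) simp_all
    qed
  qed
qed

theorem mainTheorem1:
  fixes scale :: "'v::ab_group_add \<Rightarrow> 'd::division_ring \<Rightarrow> 'v"
    and H :: "('v set \<Rightarrow> 'v set) set"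
  assumes "right_vector_space scale"
    and "has_dimension scale UNIV 2"
    and "subgroup H (BijGroup (Gr scale 1))"
    and "PEL scale \<subseteq> H" and "H \<subseteq> PGL scale"
  shows "(\<forall>x\<in>Gr scale 1. \<exists>!U.
            U \<lhd> stabilizer_group (permutation_group (Gr scale 1) H) (\<lambda>h. h) x \<and>
            acts_regularly (\<lambda>h. h) U (Gr scale 1 - {x}))
       \<and> unique_moufang_set (permutation_group (Gr scale 1) H) (\<lambda>h. h) (Gr scale 1)"
proof -
  interpret right_vector_space scale by (rule assms(1))
  obtain e f where ef: "frame scale e f" using ex_frame[OF assms(2)] by blast
  have ex1: "\<exists>!U. U \<lhd> stabilizer_group (permutation_group (Gr scale 1) H) (\<lambda>h. h) x \<and>
      acts_regularly (\<lambda>h. h) U (Gr scale 1 - {x})" if x: "x \<in> Gr scale 1" for x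
  proof -
    \<comment> \<open>The frame is started with a vector spanning \<open>x\<close>, so that
      \<open>x\<close> is its \<open>line_e\<close>.\<close>
    obtain v where v: "v \<noteq> 0" "x = range (scale v)" using x unfolding Gr_1_iff by blast
    obtain w where "frame scale v w" using frame.ex_frame_through[OF ef v(1)] by blast
    then interpret frame scale v w .
    interpret projective_line_group scale v w H
      by (intro projective_line_group.intro frame_axioms projective_line_group_axioms.intro assms(3-5))
    show ?thesis
      using ex1_normal_regular
      unfolding stabilizer_group_permutation_group v(2) line_e_def .
  qed
  moreover have "unique_moufang_set (permutation_group (Gr scale 1) H) (\<lambda>h. h) (Gr scale 1)"
    by (rule unique_moufang_set_permutation_group[OF assms(3) frame.three_lines[OF ef] ex1])
  ultimately show ?thesis by blast
qed

end
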